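(* Let $\mathcal{E}$ be a Hilbert $K(\mathcal{H})$-module and let $x, y \in \mathcal{E}$. Then the following statements are equivalent: (i) $x \| y$; (ii) there exists a unit vector $\xi \in \mathcal{H}$ such that $\big| [\langle x , y \rangle \xi , \xi ]\big| =\| x\| \| y\|$; or equivalently, (ii') there exists a unit vector $\xi\in\mathcal{H}$ such that $\big| [\langle x , y \rangle \xi , \xi ]\big| = [\langle x , x\rangle \xi , \xi ]^{\frac{1}{2}}[\langle y , y \rangle \xi , \xi ]^{\frac{1}{2}}$.
   Context: $(\mathcal{H}, [\cdot,\cdot])$ is a complex Hilbert space and $K(\mathcal{H})$ is the $C^*$-algebra of compact linear operators on $\mathcal{H}$. A (left) Hilbert $\mathcal{A}$-module over a $C^*$-algebra $\mathcal{A}$ is a left $\mathcal{A}$-module with an $\mathcal{A}$-valued inner product $\langle\cdot,\cdot\rangle$, linear in the first variable and conjugate linear in the second, such that $\langle tx,y\rangle=t\langle x,y\rangle$ for $t\in\mathcal{A}$, $\langle x,y\rangle^*=\langle y,x\rangle$, $\langle x,x\rangle\ge 0$ with equality iff $x=0$, and which is complete for the norm $\|x\|=\|\langle x,x\rangle\|^{1/2}$. Norm-parallelism: for elements $x,y$ of a complex normed space, $x\|y$ means $\|x+\lambda y\|=\|x\|+\|y\|$ for some $\lambda\in\mathbb{T}=\{\alpha\in\mathbb{C}:|\alpha|=1\}$.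
   Formalization: H is assumed nonzero, and (ii') additionally requires that [⟨x,x⟩ξ,ξ]^{1/2}[⟨y,y⟩ξ,ξ]^{1/2} = ‖x‖‖y‖, since (ii') as printed does not imply (i) (take E = H = C², x = e1, y = e2, ξ = e1). *)

theory Defs
  imports "HOL-Analysis.Analysis"
begin

section \<open>Complex normed spaces and complex Hilbert spaces\<close>

class scaleC =
  fixes scaleC :: "complex \<Rightarrow> 'a \<Rightarrow> 'a"  (infixr \<open>*\<^sub>C\<close> 75)

class complex_normed_vector = real_normed_vector + scaleC +
  assumes scaleC_add_right: "c *\<^sub>C (x + y) = c *\<^sub>C x + c *\<^sub>C y"
    and scaleC_add_left: "(c + d) *\<^sub>C x = c *\<^sub>C x + d *\<^sub>C x"
    and scaleC_scaleC: "c *\<^sub>C d *\<^sub>C x = (c * d) *\<^sub>C x"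
    and scaleC_of_real: "complex_of_real r *\<^sub>C x = r *\<^sub>R x"
    and norm_scaleC: "norm (c *\<^sub>C x) = cmod c * norm x"

class complex_banach = complex_normed_vector + complete_space

(* Linear in the first variable. The last axiom contains positive definiteness, since
   norm is already a norm. *)
class complex_hilbert_space = complex_banach +
  fixes cinner :: "'a \<Rightarrow> 'a \<Rightarrow> complex"
  assumes cinner_add_left: "cinner (x + y) z = cinner x z + cinner y z"
    and cinner_scaleC_left: "cinner (c *\<^sub>C x) y = c * cinner x y"
    and cinner_commute: "cinner y x = cnj (cinner x y)"
    and cinner_self: "cinner x x = complex_of_real ((norm x)\<^sup>2)"

definition norm_parallel :: "'a::complex_normed_vector \<Rightarrow> 'a \<Rightarrow> bool" where
  "norm_parallel x y \<longleftrightarrow> (\<exists>c. cmod c = 1 \<and> norm (x + c *\<^sub>C y) = norm x + norm y)"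


section \<open>Compact operators\<close>

lemma bounded_linear_scaleC_right:
  "bounded_linear (\<lambda>x::'a::complex_normed_vector. c *\<^sub>C x)"
proof (rule bounded_linear_intro)
  show "c *\<^sub>C (x + y) = c *\<^sub>C x + c *\<^sub>C y" for x y :: 'a
    by (rule scaleC_add_right)
  show "c *\<^sub>C (r *\<^sub>R x) = r *\<^sub>R (c *\<^sub>C x)" for r and x :: 'a
    by (simp only: scaleC_of_real [symmetric] scaleC_scaleC mult.commute)
  show "norm (c *\<^sub>C x) \<le> norm x * cmod c" for x :: 'a
    by (simp add: norm_scaleC mult.commute)
qed

instantiation blinfun :: (real_normed_vector, complex_normed_vector) scaleC
begin

lift_definition scaleC_blinfun :: "complex \<Rightarrow> 'a \<Rightarrow>\<^sub>L 'b \<Rightarrow> 'a \<Rightarrow>\<^sub>L 'b"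
  is "\<lambda>c f x. c *\<^sub>C f x"
  by (rule bounded_linear_compose [OF bounded_linear_scaleC_right])

instance ..

end

(* The type of bounded operators of the library consists of the real-linear ones, so that
   complex homogeneity is required here. Its norm is the operator norm. *)
definition compact_operators :: "('h::complex_hilbert_space \<Rightarrow>\<^sub>L 'h) set" where
  "compact_operators =
     {T. (\<forall>c \<xi>. blinfun_apply T (c *\<^sub>C \<xi>) = c *\<^sub>C blinfun_apply T \<xi>) \<and>
         compact (closure (blinfun_apply T ` cball 0 1))}"

(* S is the adjoint of T *)
definition is_adjoint :: "('h::complex_hilbert_space \<Rightarrow>\<^sub>L 'h) \<Rightarrow> ('h \<Rightarrow>\<^sub>L 'h) \<Rightarrow> bool" where
  "is_adjoint T S \<longleftrightarrow> (\<forall>\<xi> \<eta>. cinner (blinfun_apply T \<xi>) \<eta> = cinner \<xi> (blinfun_apply S \<eta>))"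

definition positive_operator :: "('h::complex_hilbert_space \<Rightarrow>\<^sub>L 'h) \<Rightarrow> bool" where
  "positive_operator T \<longleftrightarrow> (\<forall>\<xi>. cinner (blinfun_apply T \<xi>) \<xi> \<in> nonneg_Reals)"


section \<open>Hilbert modules over the compact operators\<close>

(* act is the left action of the compact operators on 'e and ip the operator-valued inner
   product; the values of act outside compact_operators are irrelevant. By norm_ip the
   norm of 'e is the one induced by ip, so completeness for that norm is the class
   complex_banach. *)
locale hilbert_compact_module =
  fixes act :: "('h::complex_hilbert_space \<Rightarrow>\<^sub>L 'h) \<Rightarrow> 'e::complex_banach \<Rightarrow> 'e"
    and ip :: "'e \<Rightarrow> 'e \<Rightarrow> 'h \<Rightarrow>\<^sub>L 'h"
  assumes act_add_right: "T \<in> compact_operators \<Longrightarrow> act T (x + y) = act T x + act T y"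
    and act_add_left: "S \<in> compact_operators \<Longrightarrow> T \<in> compact_operators \<Longrightarrow>
      act (S + T) x = act S x + act T x"
    and act_compose: "S \<in> compact_operators \<Longrightarrow> T \<in> compact_operators \<Longrightarrow>
      act (S o\<^sub>L T) x = act S (act T x)"
    and act_scaleC_left: "T \<in> compact_operators \<Longrightarrow> act (c *\<^sub>C T) x = c *\<^sub>C act T x"
    and act_scaleC_right: "T \<in> compact_operators \<Longrightarrow> act T (c *\<^sub>C x) = c *\<^sub>C act T x"
    and ip_compact: "ip x y \<in> compact_operators"
    and ip_add_left: "ip (x + y) z = ip x z + ip y z"
    and ip_scaleC_left: "ip (c *\<^sub>C x) y = c *\<^sub>C ip x y"
    and ip_add_right: "ip x (y + z) = ip x y + ip x z"
    and ip_scaleC_right: "ip x (c *\<^sub>C y) = cnj c *\<^sub>C ip x y"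
    and ip_act_left: "T \<in> compact_operators \<Longrightarrow> ip (act T x) y = T o\<^sub>L ip x y"
    and ip_adjoint: "is_adjoint (ip x y) (ip y x)"
    and ip_positive: "positive_operator (ip x x)"
    and ip_eq_0_iff: "ip x x = 0 \<longleftrightarrow> x = 0"
    and norm_ip: "norm x = sqrt (norm (ip x x))"

end

theory Submission
  imports Defs
begin

text \<open>
  Fix a unit vector \<open>\<xi>\<close>. The scalars \<open>cinner (ip x y \<xi>) \<xi>\<close> form a positive semidefinite
  Hermitian form \<open>B\<close> in \<open>x\<close> and \<open>y\<close>, and \<open>B x x \<le> (norm x)\<^sup>2\<close> because the norm of \<open>ip x x\<close> is
  \<open>(norm x)\<^sup>2\<close>. The Cauchy-Schwarz inequality therefore gives the chain
  \<open>cmod (B x y) \<le> sqrt (B x x) * sqrt (B y y) \<le> norm x * norm y\<close>. Equality of its two ends is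
  the same as equality throughout, so the two conditions on \<open>\<xi>\<close> coincide vector by vector.

  Parallelism and equality in the chain are linked by the expansion
  \<open>B (x + c y) (x + c y) = B x x + B y y + 2 Re (cnj c * B x y)\<close> for unimodular \<open>c\<close>. The left
  side is at most \<open>(norm (x + c y))\<^sup>2\<close>, and the right side is at most
  \<open>(norm x)\<^sup>2 + (norm y)\<^sup>2 + 2 cmod (B x y)\<close>. If the chain is an equality, a suitable phase \<open>c\<close>
  makes the right side equal to \<open>(norm x + norm y)\<^sup>2\<close>, which forces \<open>x\<close> and \<open>y\<close> to be parallel.
  Conversely, let \<open>norm (x + c y) = norm x + norm y\<close>. A vector \<open>\<xi>\<close> at which
  \<open>B (x + c y) (x + c y)\<close> takes its maximal value \<open>(norm (x + c y))\<^sup>2\<close> satisfies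
  \<open>cmod (B x y) = norm x * norm y\<close>.

  Only the existence of this \<open>\<xi>\<close> uses compactness: it says that a positive compact operator
  attains its norm as a value of its quadratic form on the unit sphere (lemma
  \<open>positive_compact_operator_attains_norm\<close>).
\<close>

section \<open>Positive semidefinite Hermitian forms\<close>

text \<open>
  The Cauchy-Schwarz inequality and the expansion of a square serve three forms: the inner
  product of the Hilbert space, the form of a positive operator, and the form on the module that
  a vector of the Hilbert space induces.
\<close>

locale positive_hermitian_form =
  fixes B :: "'a::complex_normed_vector \<Rightarrow> 'a \<Rightarrow> complex"
  assumes add_left: "B (x + y) z = B x z + B y z"
    and scaleC_left: "B (c *\<^sub>C x) y = c * B x y"
    and hermitian: "B y x = cnj (B x y)"
    and nonneg: "0 \<le> Re (B x x)"
begin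

lemma zero_left: "B 0 y = 0"
  using add_left[of 0 0 y] by simp

lemma add_right: "B x (y + z) = B x y + B x z"
  by (metis add_left complex_cnj_add hermitian)

lemma scaleC_right: "B x (c *\<^sub>C y) = cnj c * B x y"
  by (metis scaleC_left complex_cnj_mult hermitian)

lemma Re_form_add_scaleC:
  "Re (B (x + c *\<^sub>C y) (x + c *\<^sub>C y)) =
     Re (B x x) + (cmod c)\<^sup>2 * Re (B y y) + 2 * Re (cnj c * B x y)"
proof -
  have "B (x + c *\<^sub>C y) (x + c *\<^sub>C y) =
      B x x + c * cnj c * B y y + (cnj c * B x y + cnj (cnj c * B x y))"
    by (simp add: add_left add_right scaleC_left scaleC_right hermitian[of y x] algebra_simps)
  then show ?thesis
    by (simp add: complex_mult_cnj cmod_power2)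
qed

lemma ex_phase: "\<exists>u. cmod u = 1 \<and> cnj u * B x y = complex_of_real (cmod (B x y))"
proof (cases "B x y = 0")
  case True
  then show ?thesis by (intro exI[of _ 1]) simp
next
  case False
  have "cnj (sgn (B x y)) * B x y = complex_of_real (cmod (B x y))"
    using False complex_norm_square[of "B x y"]
    by (simp add: sgn_eq field_simps power2_eq_square)
  with False show ?thesis by (intro exI[of _ "sgn (B x y)"]) (simp add: norm_sgn)
qed

lemma Cauchy_Schwarz: "(cmod (B x y))\<^sup>2 \<le> Re (B x x) * Re (B y y)"
proof -
  obtain u where u: "cmod u = 1" "cnj u * B x y = complex_of_real (cmod (B x y))"
    using ex_phase by blast
  let ?a = "Re (B x x)" and ?b = "Re (B y y)" and ?m = "cmod (B x y)"
  have quad: "0 \<le> ?a + s\<^sup>2 * ?b + 2 * s * ?m" for s :: real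
    using nonneg[of "x + (complex_of_real s * u) *\<^sub>C y"] u
    by (simp add: Re_form_add_scaleC norm_mult mult.assoc)
  \<comment> \<open>A quadratic polynomial in \<open>s\<close> without negative values: it is tested at its vertex, or,
    if it is linear, at a point where a nonzero slope would make it equal to \<open>-1\<close>.\<close>
  show ?thesis
  proof (cases "?b = 0")
    case True
    have "?m = 0"
    proof (rule ccontr)
      assume "?m \<noteq> 0"
      with quad[of "- (?a + 1) / (2 * ?m)"] True nonneg[of x] show False
        by (simp add: field_simps)
    qed
    with True show ?thesis by simp
  next
    case False
    with nonneg[of y] have "?b > 0" by simp
    with quad[of "- ?m / ?b"] show ?thesis
      by (simp add: field_simps power2_eq_square)
  qed
qed

lemma Cauchy_Schwarz_sqrt: "cmod (B x y) \<le> sqrt (Re (B x x)) * sqrt (Re (B y y))"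
  using real_le_rsqrt[OF Cauchy_Schwarz] by (simp add: real_sqrt_mult)

end

section \<open>Norm attainment for positive compact operators\<close>

interpretation cinner: positive_hermitian_form "cinner :: 'h::complex_hilbert_space \<Rightarrow> 'h \<Rightarrow> complex"
  by unfold_locales (simp_all add: cinner_add_left cinner_scaleC_left cinner_self
      flip: cinner_commute)

lemma Re_cinner_self: "Re (cinner x x) = (norm x)\<^sup>2"
  by (simp add: cinner_self)

lemma cmod_cinner_le: "cmod (cinner x y) \<le> norm x * norm y"
  using cinner.Cauchy_Schwarz_sqrt[of x y] by (simp add: Re_cinner_self)

lemma continuous_on_Re_cinner:
  fixes f g :: "'a::topological_space \<Rightarrow> 'h::complex_hilbert_space"
  assumes "continuous_on S f" and "continuous_on S g"
  shows "continuous_on S (\<lambda>x. Re (cinner (f x) (g x)))"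
proof -
  have polarization:
    "Re (cinner x y) = ((norm (x + y))\<^sup>2 - (norm x)\<^sup>2 - (norm y)\<^sup>2) / 2" for x y :: 'h
    using arg_cong[OF cinner_commute[of y x], of Re]
    by (simp add: cinner_add_left cinner.add_right flip: Re_cinner_self)
  then show ?thesis
    using assms by (simp only: polarization) (intro continuous_intros, simp_all)
qed

lemma quadratic_form_le_norm:
  fixes T :: "'h::complex_hilbert_space \<Rightarrow>\<^sub>L 'h"
  shows "Re (cinner (blinfun_apply T \<xi>) \<xi>) \<le> norm T * (norm \<xi>)\<^sup>2"
proof -
  have "Re (cinner (blinfun_apply T \<xi>) \<xi>) \<le> norm (blinfun_apply T \<xi>) * norm \<xi>"
    using complex_Re_le_cmod cmod_cinner_le by (rule order_trans)
  also have "\<dots> \<le> norm T * norm \<xi> * norm \<xi>"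
    by (intro mult_right_mono norm_blinfun) simp
  finally show ?thesis by (simp add: power2_eq_square mult.assoc)
qed

text \<open>
  For \<open>v = T \<xi>\<close> with \<open>norm \<xi> \<le> 1\<close>, Cauchy-Schwarz for the form of \<open>T\<close> gives
  \<open>(norm v)^4 \<le> cinner (T \<xi>) \<xi> * cinner (T v) v \<le> norm T * cinner (T v) v\<close>. The outer
  inequality concerns \<open>v\<close> alone and is a closed condition, so it passes to the compact closure of the image of the unit ball. There it can be used at a vector
  \<open>\<eta>\<close> of largest norm, and this norm is at least \<open>norm T\<close>. After normalisation, \<open>\<eta>\<close> is the
  required vector.
\<close>

lemma positive_compact_operator_attains_norm:
  fixes T :: "'h::complex_hilbert_space \<Rightarrow>\<^sub>L 'h"
  assumes compact: "T \<in> compact_operators"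
    and self_adjoint: "is_adjoint T T"
    and positive: "positive_operator T"
    and nontrivial: "\<exists>\<zeta>::'h. \<zeta> \<noteq> 0"
  shows "\<exists>\<xi>. norm \<xi> = 1 \<and> Re (cinner (blinfun_apply T \<xi>) \<xi>) = norm T"
proof (cases "T = 0")
  case True
  obtain \<zeta> :: 'h where "\<zeta> \<noteq> 0" using nontrivial by blast
  with True show ?thesis
    by (intro exI[of _ "sgn \<zeta>"]) (simp add: norm_sgn cinner.zero_left)
next
  case False
  interpret T: positive_hermitian_form "\<lambda>\<xi> \<eta>. cinner (blinfun_apply T \<xi>) \<eta>"
  proof
    show "cinner (blinfun_apply T (c *\<^sub>C \<xi>)) \<eta> = c * cinner (blinfun_apply T \<xi>) \<eta>" for c \<xi> \<eta>
      using compact by (simp add: compact_operators_def cinner_scaleC_left)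
    show "cinner (blinfun_apply T \<eta>) \<xi> = cnj (cinner (blinfun_apply T \<xi>) \<eta>)" for \<xi> \<eta>
      using self_adjoint unfolding is_adjoint_def by (metis cinner_commute)
    show "0 \<le> Re (cinner (blinfun_apply T \<xi>) \<xi>)" for \<xi>
      using positive unfolding positive_operator_def by (auto simp: complex_nonneg_Reals_iff)
  qed (simp add: blinfun.add_right cinner_add_left)
  let ?q = "\<lambda>v. Re (cinner (blinfun_apply T v) v)"
  let ?K = "closure (blinfun_apply T ` cball 0 1)"
  have key: "norm v ^ 4 \<le> norm T * ?q v" if "v \<in> ?K" for v
  proof -
    have "closed {v. norm v ^ 4 \<le> norm T * ?q v}"
      by (intro closed_Collect_le continuous_intros continuous_on_Re_cinner)
    moreover have "blinfun_apply T ` cball 0 1 \<subseteq> {v. norm v ^ 4 \<le> norm T * ?q v}"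
    proof clarsimp
      fix \<xi> :: 'h assume \<xi>: "norm \<xi> \<le> 1"
      let ?v = "blinfun_apply T \<xi>"
      have "norm ?v ^ 4 = (cmod (cinner ?v ?v))\<^sup>2"
        by (simp add: cinner_self norm_power flip: power_mult)
      also have "\<dots> \<le> ?q \<xi> * ?q ?v"
        by (rule T.Cauchy_Schwarz)
      also have "?q \<xi> \<le> norm T"
        using quadratic_form_le_norm[of T \<xi>] mult_left_mono[of "(norm \<xi>)\<^sup>2" 1 "norm T"] \<xi>
        by (simp add: power_le_one)
      then have "?q \<xi> * ?q ?v \<le> norm T * ?q ?v"
        by (rule mult_right_mono) (rule T.nonneg)
      finally show "norm ?v ^ 4 \<le> norm T * ?q ?v" .
    qed
    ultimately show ?thesis
      using closure_minimal that by blast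
  qed
  have "compact ?K"
    using compact by (simp add: compact_operators_def)
  moreover have "?K \<noteq> {}" by simp
  ultimately obtain \<eta> where \<eta>: "\<eta> \<in> ?K" and max: "\<And>v. v \<in> ?K \<Longrightarrow> norm v \<le> norm \<eta>"
    using continuous_attains_sup[of ?K norm] continuous_on_norm_id by blast
  have le: "norm T \<le> norm \<eta>"
  proof (rule norm_blinfun_bound)
    fix \<xi> :: 'h
    show "norm (blinfun_apply T \<xi>) \<le> norm \<eta> * norm \<xi>"
    proof (cases "\<xi> = 0")
      case False
      then have "norm (blinfun_apply T (sgn \<xi>)) \<le> norm \<eta>"
        by (intro max closure_subset[THEN subsetD] imageI) (simp add: norm_sgn)
      with False show ?thesis
        by (simp add: sgn_div_norm blinfun.scaleR_right field_simps)
    qed simp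
  qed simp
  have pos: "0 < norm T" and "\<eta> \<noteq> 0" using False le by auto
  let ?\<zeta> = "complex_of_real (inverse (norm \<eta>)) *\<^sub>C \<eta>"
  have unit: "norm ?\<zeta> = 1"
    using \<open>\<eta> \<noteq> 0\<close> by (simp add: norm_scaleC norm_inverse)
  have "?q ?\<zeta> = ?q \<eta> / (norm \<eta>)\<^sup>2"
    by (simp add: T.scaleC_left T.scaleC_right power2_eq_square divide_inverse
        flip: of_real_inverse)
  moreover have "norm T * norm T * (norm \<eta>)\<^sup>2 \<le> norm T * ?q \<eta>"
  proof -
    have "norm T * norm T * (norm \<eta>)\<^sup>2 \<le> norm \<eta> * norm \<eta> * (norm \<eta>)\<^sup>2"
      using le by (intro mult_right_mono mult_mono) simp_all
    also have "\<dots> = norm \<eta> ^ 4" by (simp add: power2_eq_square power4_eq_xxxx)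
    also have "\<dots> \<le> norm T * ?q \<eta>" using key \<eta> by blast
    finally show ?thesis .
  qed
  then have "norm T \<le> ?q \<eta> / (norm \<eta>)\<^sup>2"
    using pos \<open>\<eta> \<noteq> 0\<close> by (simp add: field_simps)
  ultimately have "norm T \<le> ?q ?\<zeta>" by simp
  moreover have "?q ?\<zeta> \<le> norm T"
    using quadratic_form_le_norm[of T ?\<zeta>] by (simp only: unit) simp
  ultimately show ?thesis
    using unit by (intro exI[of _ ?\<zeta>] conjI) linarith+
qed

section \<open>Parallelism in Hilbert modules over the compact operators\<close>

context hilbert_compact_module
begin

lemma ip_form: "positive_hermitian_form (\<lambda>x y. cinner (blinfun_apply (ip x y) \<xi>) \<xi>)"
proof
  show "cinner (blinfun_apply (ip y x) \<xi>) \<xi> = cnj (cinner (blinfun_apply (ip x y) \<xi>) \<xi>)" for x y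
    using ip_adjoint[of y x] unfolding is_adjoint_def by (metis cinner_commute)
  show "0 \<le> Re (cinner (blinfun_apply (ip x x) \<xi>) \<xi>)" for x
    using ip_positive[of x] unfolding positive_operator_def
    by (auto simp: complex_nonneg_Reals_iff)
qed (simp_all add: ip_add_left ip_scaleC_left blinfun.add_left cinner_add_left
    cinner_scaleC_left scaleC_blinfun.rep_eq)

lemma norm_ip_self: "norm (ip x x) = (norm x)\<^sup>2"
  by (simp add: norm_ip)

lemma ip_form_self_le:
  assumes "norm \<xi> = 1"
  shows "Re (cinner (blinfun_apply (ip x x) \<xi>) \<xi>) \<le> (norm x)\<^sup>2"
  using quadratic_form_le_norm[of "ip x x" \<xi>] assms by (simp add: norm_ip_self)

lemma ip_form_sqrt_le:
  assumes "norm \<xi> = 1"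
  shows "sqrt (Re (cinner (blinfun_apply (ip x x) \<xi>) \<xi>)) *
    sqrt (Re (cinner (blinfun_apply (ip y y) \<xi>) \<xi>)) \<le> norm x * norm y"
proof -
  interpret positive_hermitian_form "\<lambda>x y. cinner (blinfun_apply (ip x y) \<xi>) \<xi>"
    by (rule ip_form)
  show ?thesis
    by (intro mult_mono real_le_lsqrt ip_form_self_le assms) (simp_all add: nonneg)
qed

lemma equality_throughout_iff:
  assumes "norm \<xi> = 1"
  shows "cmod (cinner (blinfun_apply (ip x y) \<xi>) \<xi>) = norm x * norm y \<longleftrightarrow>
    cmod (cinner (blinfun_apply (ip x y) \<xi>) \<xi>) =
      sqrt (Re (cinner (blinfun_apply (ip x x) \<xi>) \<xi>)) *
      sqrt (Re (cinner (blinfun_apply (ip y y) \<xi>) \<xi>)) \<and>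
    sqrt (Re (cinner (blinfun_apply (ip x x) \<xi>) \<xi>)) *
      sqrt (Re (cinner (blinfun_apply (ip y y) \<xi>) \<xi>)) = norm x * norm y"
  using positive_hermitian_form.Cauchy_Schwarz_sqrt[OF ip_form, of x y \<xi>]
    ip_form_sqrt_le[OF assms, of x y] by linarith

text \<open>
  When \<open>x\<close> and \<open>y\<close> are nonzero, equality in the chain pins \<open>B x x\<close> and \<open>B y y\<close> to their maximal
  values, so the phase of \<open>B x y\<close> makes \<open>B (x + c y) (x + c y)\<close> equal to
  \<open>(norm x + norm y)\<^sup>2\<close>. If one of them vanishes there is no information in the equality, but
  then \<open>c = 1\<close> works.
\<close>

lemma norm_parallel_if_attained:
  assumes \<xi>: "norm \<xi> = 1"
    and eq: "cmod (cinner (blinfun_apply (ip x y) \<xi>) \<xi>) = norm x * norm y"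
  shows "norm_parallel x y"
proof (cases "x = 0 \<or> y = 0")
  case True
  have "1 *\<^sub>C z = z" for z :: 'e
    using scaleC_of_real[of 1 z] by simp
  with True show ?thesis
    unfolding norm_parallel_def by (intro exI[of _ 1]) auto
next
  case False
  interpret positive_hermitian_form "\<lambda>x y. cinner (blinfun_apply (ip x y) \<xi>) \<xi>"
    by (rule ip_form)
  let ?B = "\<lambda>x y. cinner (blinfun_apply (ip x y) \<xi>) \<xi>"
  have prod: "(norm x)\<^sup>2 * (norm y)\<^sup>2 \<le> Re (?B x x) * Re (?B y y)"
    using Cauchy_Schwarz[of x y] by (simp add: eq power_mult_distrib)
  have "(norm x)\<^sup>2 * (norm y)\<^sup>2 \<le> Re (?B x x) * (norm y)\<^sup>2"
    using prod mult_left_mono[OF ip_form_self_le[OF \<xi>, of y] nonneg[of x]] by linarith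
  then have Bx: "(norm x)\<^sup>2 \<le> Re (?B x x)" using False by simp
  have "(norm x)\<^sup>2 * (norm y)\<^sup>2 \<le> (norm x)\<^sup>2 * Re (?B y y)"
    using prod mult_right_mono[OF ip_form_self_le[OF \<xi>, of x] nonneg[of y]] by linarith
  then have By: "(norm y)\<^sup>2 \<le> Re (?B y y)" using False by simp
  obtain c where c: "cmod c = 1" "cnj c * ?B x y = complex_of_real (cmod (?B x y))"
    using ex_phase by blast
  have "(norm x + norm y)\<^sup>2 \<le> Re (?B x x) + Re (?B y y) + 2 * cmod (?B x y)"
    using Bx By by (simp add: eq power2_sum)
  also have "\<dots> = Re (?B (x + c *\<^sub>C y) (x + c *\<^sub>C y))"
    using Re_form_add_scaleC[of x c y] by (simp only: c) simp
  also have "\<dots> \<le> (norm (x + c *\<^sub>C y))\<^sup>2"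
    by (rule ip_form_self_le[OF \<xi>])
  finally have "norm x + norm y \<le> norm (x + c *\<^sub>C y)"
    by (rule power2_le_imp_le) simp
  moreover have "norm (x + c *\<^sub>C y) \<le> norm x + norm y"
    using norm_triangle_ineq[of x "c *\<^sub>C y"] by (simp add: norm_scaleC c)
  ultimately show ?thesis
    unfolding norm_parallel_def using c(1) by (intro exI[of _ c]) simp
qed

lemma attained_if_norm_parallel:
  assumes "\<exists>\<zeta>::'h. \<zeta> \<noteq> 0" and "norm_parallel x y"
  shows "\<exists>\<xi>. norm \<xi> = 1 \<and> cmod (cinner (blinfun_apply (ip x y) \<xi>) \<xi>) = norm x * norm y"
proof -
  obtain c where c: "cmod c = 1" and sum: "norm (x + c *\<^sub>C y) = norm x + norm y"
    using assms(2) unfolding norm_parallel_def by blast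
  obtain \<xi> where \<xi>: "norm \<xi> = 1"
    and max: "Re (cinner (blinfun_apply (ip (x + c *\<^sub>C y) (x + c *\<^sub>C y)) \<xi>) \<xi>) =
      (norm (x + c *\<^sub>C y))\<^sup>2"
    using positive_compact_operator_attains_norm[OF ip_compact ip_adjoint ip_positive assms(1)]
    by (metis norm_ip_self)
  interpret positive_hermitian_form "\<lambda>x y. cinner (blinfun_apply (ip x y) \<xi>) \<xi>"
    by (rule ip_form)
  let ?B = "\<lambda>x y. cinner (blinfun_apply (ip x y) \<xi>) \<xi>"
  have "(norm x + norm y)\<^sup>2 = Re (?B x x) + Re (?B y y) + 2 * Re (cnj c * ?B x y)"
    using max Re_form_add_scaleC[of x c y] by (simp only: sum c) simp
  also have "\<dots> \<le> (norm x)\<^sup>2 + (norm y)\<^sup>2 + 2 * cmod (?B x y)"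
    using ip_form_self_le[OF \<xi>, of x] ip_form_self_le[OF \<xi>, of y]
      complex_Re_le_cmod[of "cnj c * ?B x y"] by (simp add: norm_mult c)
  finally have "norm x * norm y \<le> cmod (?B x y)"
    by (simp add: power2_sum)
  moreover have "cmod (?B x y) \<le> norm x * norm y"
    using Cauchy_Schwarz_sqrt ip_form_sqrt_le[OF \<xi>] by (rule order_trans)
  ultimately show ?thesis
    using \<xi> by (intro exI[of _ \<xi>]) simp
qed

end

theorem theorem2p1:
  fixes act :: "('h::complex_hilbert_space \<Rightarrow>\<^sub>L 'h) \<Rightarrow> 'e::complex_banach \<Rightarrow> 'e"
    and ip :: "'e \<Rightarrow> 'e \<Rightarrow> 'h \<Rightarrow>\<^sub>L 'h"
    and x y :: 'e
  assumes "hilbert_compact_module act ip"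
    and "\<exists>\<zeta>::'h. \<zeta> \<noteq> 0"
  shows "(norm_parallel x y \<longleftrightarrow>
           (\<exists>\<xi>::'h. norm \<xi> = 1 \<and>
              cmod (cinner (blinfun_apply (ip x y) \<xi>) \<xi>) = norm x * norm y)) \<and>
         (norm_parallel x y \<longleftrightarrow>
           (\<exists>\<xi>::'h. norm \<xi> = 1 \<and>
              cmod (cinner (blinfun_apply (ip x y) \<xi>) \<xi>) =
                sqrt (Re (cinner (blinfun_apply (ip x x) \<xi>) \<xi>)) *
                sqrt (Re (cinner (blinfun_apply (ip y y) \<xi>) \<xi>)) \<and>
              sqrt (Re (cinner (blinfun_apply (ip x x) \<xi>) \<xi>)) *
                sqrt (Re (cinner (blinfun_apply (ip y y) \<xi>) \<xi>)) = norm x * norm y))"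
proof -
  interpret hilbert_compact_module act ip by fact
  have "norm_parallel x y \<longleftrightarrow>
      (\<exists>\<xi>. norm \<xi> = 1 \<and> cmod (cinner (blinfun_apply (ip x y) \<xi>) \<xi>) = norm x * norm y)"
    using attained_if_norm_parallel[OF assms(2)] norm_parallel_if_attained by blast
  then show ?thesis
    using equality_throughout_iff[of _ x y] by blast
qed

end
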